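(* Let $G$ be a finite abelian group of odd order and $S$ a sequence over $G$ such that $0$ is not a term of $S$ and $N_0(S) = 2^{|S|-D(G)+1}$. Then $S$ contains exactly $|S|-D(G)+1$ minimal zero-sum subsequences, and these are pairwise disjoint.
   Context: A sequence over $G$ is a finite unordered list $S = g_1 \cdots g_m$ of elements of $G$ with repetition allowed (an element of the free abelian monoid on $G$); $|S| = m$; subsequences are sub-multisets (divisors in this monoid). $N_0(S) = |\{I \subseteq [1,m] : \sum_{i\in I} g_i = 0\}|$ (empty index set included). $D(G)$ is the smallest positive integer $\ell$ such that every sequence over $G$ of length at least $\ell$ has a nonempty subsequence with sum $0$. A minimal zero-sum sequence is a nonempty sequence with sum $0$ none of whose nonempty proper subsequences has sum $0$. Two subsequences $T_1,T_2$ are disjoint if their greatest common divisor $\gcd(T_1,T_2)$ (the longest sequence dividing both) is the empty sequence. *)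

theory Defs
  imports Complex_Main "HOL-Library.Multiset" "HOL-Library.Cardinality" "HOL-Combinatorics.List_Permutation"
begin

text \<open>Sequences over the group \<open>G\<close> are multisets over the type \<open>'a\<close>; the length is \<open>size\<close>,
  subsequences are given by \<open>\<subseteq>#\<close>, and the greatest common divisor is \<open>\<inter>#\<close>.\<close>

definition davenport :: "'a::ab_group_add itself \<Rightarrow> nat" where
  "davenport _ = (LEAST l. 0 < l \<and>
     (\<forall>S :: 'a multiset. l \<le> size S \<longrightarrow> (\<exists>T. T \<subseteq># S \<and> T \<noteq> {#} \<and> \<Sum>\<^sub># T = 0)))"

definition minimal_zero_sum :: "'a::ab_group_add multiset \<Rightarrow> bool" where
  "minimal_zero_sum S \<longleftrightarrow> S \<noteq> {#} \<and> \<Sum>\<^sub># S = 0 \<and>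
     (\<forall>T. T \<subset># S \<and> T \<noteq> {#} \<longrightarrow> \<Sum>\<^sub># T \<noteq> 0)"

text \<open>Index sets refer to an enumeration \<open>g\<^sub>1 \<cdots> g\<^sub>m\<close> of the terms. The enumeration
  is chosen arbitrarily; lemma \<open>N0_mset\<close> shows that the count does not depend on it.\<close>

definition N0 :: "'a::ab_group_add multiset \<Rightarrow> nat" where
  "N0 S = (let g = (SOME g. mset g = S) in
     card {I. I \<subseteq> {..<length g} \<and> (\<Sum>i\<in>I. g ! i) = 0})"

lemma card_zero_sum_index_sets_cong:
  fixes xs ys :: "'a::ab_group_add list"
  assumes "mset xs = mset ys"
  shows "card {I. I \<subseteq> {..<length xs} \<and> (\<Sum>i\<in>I. xs ! i) = 0} =
         card {I. I \<subseteq> {..<length ys} \<and> (\<Sum>i\<in>I. ys ! i) = 0}"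
proof -
  obtain f where f: "bij_betw f {..<length xs} {..<length ys}"
    and nth: "\<And>i. i < length xs \<Longrightarrow> xs ! i = ys ! f i"
    using permutation_Ex_bij[OF assms] by blast
  have sum_image: "(\<Sum>j\<in>f ` I. ys ! j) = (\<Sum>i\<in>I. xs ! i)" if "I \<subseteq> {..<length xs}" for I
  proof -
    have "inj_on f I"
      using f that by (meson bij_betw_def inj_on_subset)
    then have "(\<Sum>j\<in>f ` I. ys ! j) = (\<Sum>i\<in>I. ys ! f i)"
      by (simp add: sum.reindex)
    also have "\<dots> = (\<Sum>i\<in>I. xs ! i)"
      using that nth by (intro sum.cong) auto
    finally show ?thesis .
  qed
  have "bij_betw ((`) f) (Pow {..<length xs}) (Pow {..<length ys})"
    using f by (rule bij_betw_Pow)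
  then have inj: "inj_on ((`) f) (Pow {..<length xs})"
    and img: "(`) f ` Pow {..<length xs} = Pow {..<length ys}"
    by (simp_all only: bij_betw_def)
  let ?A = "{I. I \<subseteq> {..<length xs} \<and> (\<Sum>i\<in>I. xs ! i) = 0}"
  let ?B = "{I. I \<subseteq> {..<length ys} \<and> (\<Sum>i\<in>I. ys ! i) = 0}"
  have "(`) f ` ?A = ?B"
  proof (intro equalityI subsetI)
    fix J assume "J \<in> (`) f ` ?A"
    then obtain I where I: "I \<subseteq> {..<length xs}" "(\<Sum>i\<in>I. xs ! i) = 0" "J = f ` I"
      by auto
    moreover have "f ` I \<subseteq> {..<length ys}"
      using f I(1) by (auto simp: bij_betw_def)
    ultimately show "J \<in> ?B"
      using sum_image[OF I(1)] by simp
  next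
    fix J assume J: "J \<in> ?B"
    then have "J \<in> (`) f ` Pow {..<length xs}"
      by (simp add: img)
    then obtain I where I: "I \<subseteq> {..<length xs}" "J = f ` I"
      by (elim imageE) simp
    have "I \<in> ?A"
      using J I sum_image[OF I(1)] by simp
    then show "J \<in> (`) f ` ?A"
      unfolding I(2) by (rule imageI)
  qed
  moreover have "inj_on ((`) f) ?A"
    using inj by (rule inj_on_subset) auto
  ultimately show ?thesis
    using card_image[of "(`) f" ?A] by simp
qed

lemma N0_mset:
  "N0 (mset g) = card {I. I \<subseteq> {..<length g} \<and> (\<Sum>i\<in>I. g ! i) = 0}"
proof -
  have "mset (SOME g'. mset g' = mset g) = mset g"
    by (rule someI) simp
  then show ?thesis
    unfolding N0_def Let_def by (rule card_zero_sum_index_sets_cong)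
qed

end

theory Submission
  imports Defs "HOL-Computational_Algebra.Primes"
begin

text \<open>Let \<open>F\<close> be the family of zero-sum index sets, viewed as vectors over the field with two elements. If an
  index lies in some but not all members of \<open>F\<close>, it splits \<open>F\<close> into two solution families of the shorter
  sequence. Each has at least half of the extremal size, so both are extremal again, and by
  induction both are affine subspaces. A family of \<open>2 ^ k\<close> vectors all of whose coordinate halves are affine
  is affine itself, so \<open>F\<close> is closed under symmetric difference. In odd order,
  \<open>2 \<sigma>(I \<inter> J) = \<sigma>(I) + \<sigma>(J) - \<sigma>(I \<triangle> J)\<close> then makes \<open>F\<close> closed under
  intersection: the minimal members are pairwise disjoint, and \<open>F\<close> consists of their unions.\<close>

section \<open>Affine families of sets over the two-element field\<close>

text \<open>The sum \<open>A + B + C\<close> of indicator vectors modulo 2: membership in an odd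
  number of the three sets. A nonempty family is an affine subspace iff it is closed under this
  operation.\<close>

definition xor3 :: "'i set \<Rightarrow> 'i set \<Rightarrow> 'i set \<Rightarrow> 'i set" where
  "xor3 A B C = {i. (i \<in> A) = ((i \<in> B) = (i \<in> C))}"

lemma mem_xor3 [simp]: "i \<in> xor3 A B C \<longleftrightarrow> ((i \<in> A) = ((i \<in> B) = (i \<in> C)))"
  by (simp add: xor3_def)

definition separates :: "'i set set \<Rightarrow> 'i \<Rightarrow> bool" where
  "separates F i \<longleftrightarrow> (\<exists>A\<in>F. i \<in> A) \<and> (\<exists>A\<in>F. i \<notin> A)"

text \<open>Write \<open>+\<close> for addition modulo 2. Agreement at \<open>i\<close> puts
  \<open>E = A + B + D\<close> into \<open>F\<close>, and \<open>C\<close> must differ from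
  \<open>A\<close> at \<open>j\<close>, since otherwise \<open>loc\<close> at \<open>j\<close> would
  put \<open>A + B + C\<close> into \<open>F\<close>. If \<open>D\<close> differed from
  \<open>A\<close> at \<open>j\<close> as well, then \<open>D\<close>, \<open>E\<close> and
  \<open>C\<close> would agree there, and \<open>D + E + C = A + B + C\<close> would lie in
  \<open>F\<close>.\<close>

lemma bad_triple_class:
  assumes loc: "\<And>i A B C. \<lbrakk>separates F i; A \<in> F; B \<in> F; C \<in> F; (i \<in> A) = (i \<in> B); (i \<in> B) = (i \<in> C)\<rbrakk>
      \<Longrightarrow> xor3 A B C \<in> F"
    and "A \<in> F" "B \<in> F" "C \<in> F" "D \<in> F" and bad: "xor3 A B C \<notin> F"
    and i: "separates F i" "(i \<in> A) = (i \<in> B)" "(i \<in> D) = (i \<in> A)"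
    and j: "separates F j" "(j \<in> A) = (j \<in> B)"
  shows "(j \<in> D) = (j \<in> A)"
proof (rule ccontr)
  assume neq: "(j \<in> D) \<noteq> (j \<in> A)"
  let ?E = "xor3 A B D"
  have E: "?E \<in> F"
    using loc[OF i(1) \<open>A \<in> F\<close> \<open>B \<in> F\<close> \<open>D \<in> F\<close> i(2)] i(2,3) by metis
  have "(j \<in> C) \<noteq> (j \<in> A)"
    using loc[OF j(1) \<open>A \<in> F\<close> \<open>B \<in> F\<close> \<open>C \<in> F\<close>] j bad by metis
  then have "xor3 D ?E C \<in> F"
    using loc[OF j(1) \<open>D \<in> F\<close> E \<open>C \<in> F\<close>] j neq by auto
  moreover have "xor3 D ?E C = xor3 A B C"
    by auto
  ultimately show False
    using bad by simp
qed

text \<open>A triple violating the conclusion splits the separating coordinates into three classes,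
  according to the member that is outvoted by the other two. Every member of \<open>F\<close> follows the majority on
  all of a class or on none of it, so \<open>F\<close> has at most seven members; but it has at least five.\<close>

lemma xor3_closed_of_local:
  fixes F :: "'i set set"
  assumes card: "card F = 2 ^ k"
    and loc: "\<And>i A B C. \<lbrakk>separates F i; A \<in> F; B \<in> F; C \<in> F; (i \<in> A) = (i \<in> B); (i \<in> B) = (i \<in> C)\<rbrakk>
      \<Longrightarrow> xor3 A B C \<in> F"
    and ABC: "A \<in> F" "B \<in> F" "C \<in> F"
  shows "xor3 A B C \<in> F"
proof (rule ccontr)
  assume bad: "xor3 A B C \<notin> F"
  have fin: "finite F"
    using card by (metis card.infinite power_not_zero zero_neq_numeral)
  have perm: "xor3 A C B = xor3 A B C" "xor3 B C A = xor3 A B C"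
    by auto
  have "A \<noteq> B" "A \<noteq> C" "B \<noteq> C"
  proof -
    have "xor3 X X Y = Y" for X Y :: "'i set"
      by auto
    then show "A \<noteq> B" "A \<noteq> C" "B \<noteq> C"
      using bad ABC perm by metis+
  qed
  \<comment> \<open>The choice of \<open>i\<close> is immaterial: by
    \<open>bad_triple_class\<close>, following the pair at one coordinate of its class means
    following it on the whole class. This is what \<open>maj_AB\<close>, \<open>maj_AC\<close> and
    \<open>maj_BC\<close> record.\<close>
  define maj where "maj P Q D \<longleftrightarrow> (\<exists>i. separates F i \<and> (i \<in> P) = (i \<in> Q) \<and> (i \<in> D) = (i \<in> P))"
    for P Q D :: "'i set"
  have maj_AB: "maj A B D \<longleftrightarrow> (i \<in> D) = (i \<in> A)"
    if "D \<in> F" "separates F i" "(i \<in> A) = (i \<in> B)" for D i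
    using bad_triple_class[of F A B C D _ i] loc ABC bad that unfolding maj_def by blast
  have maj_AC: "maj A C D \<longleftrightarrow> (i \<in> D) = (i \<in> A)"
    if "D \<in> F" "separates F i" "(i \<in> A) = (i \<in> C)" for D i
    using bad_triple_class[of F A C B D _ i] loc ABC bad that unfolding maj_def perm by blast
  have maj_BC: "maj B C D \<longleftrightarrow> (i \<in> D) = (i \<in> B)"
    if "D \<in> F" "separates F i" "(i \<in> B) = (i \<in> C)" for D i
    using bad_triple_class[of F B C A D _ i] loc ABC bad that unfolding maj_def perm by blast
  have const: "(i \<in> P) = (i \<in> Q)" if "\<not> separates F i" "P \<in> F" "Q \<in> F" for i P Q
    using that unfolding separates_def by blast
  \<comment> \<open>By \<open>loc\<close> and \<open>bad\<close>, the three sets never all agree at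
    a separating coordinate. A \<open>D\<close> following no pair would take the minority value at
    each of them, which is the value of the sum of the three, so \<open>D\<close> would be
    \<open>xor3 A B C\<close>.\<close>
  have ex_maj: "maj A B D \<or> maj A C D \<or> maj B C D" if "D \<in> F" for D
  proof -
    obtain i where i: "(i \<in> D) \<noteq> (i \<in> xor3 A B C)"
      using bad \<open>D \<in> F\<close> by (metis subsetI subset_antisym)
    then have "separates F i"
      using const[of i] ABC that by (metis mem_xor3)
    then show ?thesis
      using i loc[of i A B C] ABC bad unfolding maj_def mem_xor3 by blast
  qed
  let ?\<phi> = "\<lambda>D. (maj A B D, maj A C D, maj B C D)"
  \<comment> \<open>Every separating coordinate lies in one of the classes, so three bits determine
    a member of \<open>F\<close>; \<open>ex_maj\<close> excludes one of the eight triples.\<close>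
  have "inj_on ?\<phi> F"
  proof (rule inj_onI)
    fix D E assume DE: "D \<in> F" "E \<in> F" and eq: "?\<phi> D = ?\<phi> E"
    have "(i \<in> D) = (i \<in> E)" for i
    proof (cases "separates F i")
      case True
      consider "(i \<in> A) = (i \<in> B)" | "(i \<in> A) = (i \<in> C)" | "(i \<in> B) = (i \<in> C)"
        by blast
      then show ?thesis
        using maj_AB[OF DE(1) True] maj_AB[OF DE(2) True] maj_AC[OF DE(1) True] maj_AC[OF DE(2) True]
          maj_BC[OF DE(1) True] maj_BC[OF DE(2) True] eq by cases auto
    qed (use const DE in blast)
    then show "D = E"
      by blast
  qed
  moreover have "?\<phi> ` F \<subseteq> UNIV - {(False, False, False)}"
    using ex_maj by auto
  ultimately have "card F \<le> card (UNIV - {(False, False, False)})"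
    by (intro card_inj_on_le) auto
  also have "\<dots> = 7"
    by (simp add: card_Diff_singleton card_UNIV_bool flip: UNIV_Times_UNIV)
  finally have le7: "card F \<le> 7" .
  have card3: "card {A, B, C} = 3"
    using \<open>A \<noteq> B\<close> \<open>A \<noteq> C\<close> \<open>B \<noteq> C\<close> by simp
  have no_pow: "card F \<notin> {3, 5, 6, 7}"
  proof -
    have "k < 3"
    proof (rule ccontr)
      assume "\<not> k < 3"
      then have "(2::nat) ^ 3 \<le> 2 ^ k"
        by (intro power_increasing) auto
      then show False
        using le7 card by simp
    qed
    then have "k = 0 \<or> k = 1 \<or> k = 2"
      by auto
    then show ?thesis
      using card by auto
  qed
  have "{A, B, C} \<noteq> F"
    using card3 no_pow by auto
  then obtain D where D: "D \<in> F" "D \<notin> {A, B, C}"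
    using ABC by blast
  \<comment> \<open>\<open>D\<close> follows some pair \<open>P\<close>, \<open>Q\<close>, so
    \<open>P + Q + D\<close> lies in \<open>F\<close>. It differs from the third set
    \<open>R\<close> because \<open>D\<close> is in \<open>F\<close> while \<open>P + Q + R\<close>
    is not.\<close>
  have fifth: "\<exists>E\<in>F. E \<notin> {A, B, C, D}"
  proof -
    have *: "xor3 P Q D \<notin> {P, Q, R, D}"
      if "P \<noteq> Q" "D \<noteq> P" "D \<noteq> Q" "D \<noteq> xor3 P Q R" for P Q R :: "'i set"
    proof -
      have "xor3 P Q (xor3 P Q D) = D" "xor3 P Q P = Q" "xor3 P Q Q = P"
        "xor3 P D (xor3 P Q D) = Q" "xor3 P D D = P"
        by auto
      then show ?thesis
        using that by (metis insert_iff empty_iff)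
    qed
    have **: "xor3 P Q D \<in> F" if "maj P Q D" "P \<in> F" "Q \<in> F" for P Q
      using that loc D unfolding maj_def by blast
    consider "maj A B D" | "maj A C D" | "maj B C D"
      using ex_maj[OF D(1)] by blast
    then show ?thesis
    proof cases
      case 1
      then show ?thesis
        using **[of A B] *[of A B C] ABC D bad \<open>A \<noteq> B\<close> by blast
    next
      case 2
      then show ?thesis
        using **[of A C] *[of A C B] ABC D bad \<open>A \<noteq> C\<close> unfolding perm by blast
    next
      case 3
      then show ?thesis
        using **[of B C] *[of B C A] ABC D bad \<open>B \<noteq> C\<close> unfolding perm by blast
    qed
  qed
  then obtain E where E: "E \<in> F" "E \<notin> {A, B, C, D}"
    by blast
  have "E \<notin> insert D {A, B, C}"
    using E by blast
  then have "card (insert E (insert D {A, B, C})) = Suc (Suc 3)"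
    using D(2) card3 by (metis card_insert_disjoint finite.intros)
  moreover have "card (insert E (insert D {A, B, C})) \<le> card F"
    using ABC D(1) E(1) by (intro card_mono[OF fin]) blast
  ultimately have "5 \<le> card F"
    by simp
  then have "card F \<in> {5, 6, 7}"
    using le7 by auto
  then show False
    using no_pow by auto
qed

section \<open>Zero-sum subsequences and the Davenport constant\<close>

text \<open>Pigeonhole on the \<open>length xs + 1\<close> prefix sums: two of them coincide, and
  the block between them has sum zero.\<close>

lemma zero_sum_sublist:
  fixes xs :: "'a::{ab_group_add, finite} list"
  assumes "CARD('a) \<le> length xs"
  shows "\<exists>ys. mset ys \<subseteq># mset xs \<and> ys \<noteq> [] \<and> sum_list ys = 0"
proof -
  let ?s = "\<lambda>n. sum_list (take n xs)"
  have "\<not> inj_on ?s {..length xs}"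
  proof
    assume "inj_on ?s {..length xs}"
    then have "card {..length xs} \<le> CARD('a)"
      by (intro card_inj_on_le) auto
    then show False
      using assms by simp
  qed
  then obtain m n where mn: "m < n" "n \<le> length xs" "?s m = ?s n"
    unfolding inj_on_def by (metis atMost_iff linorder_neqE_nat)
  let ?ys = "take (n - m) (drop m xs)"
  have "take n xs = take m xs @ ?ys"
    using mn by (metis le_add_diff_inverse less_imp_le_nat take_add)
  then have "sum_list ?ys = 0"
    using mn(3) by simp
  moreover have "?ys \<noteq> []"
    using mn by auto
  moreover have "mset ?ys \<subseteq># mset xs"
  proof -
    have "xs = take m xs @ ?ys @ drop (n - m) (drop m xs)"
      by (metis append_take_drop_id)
    then have "mset xs = mset (take m xs) + mset ?ys + mset (drop (n - m) (drop m xs))"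
      by (metis mset_append add.assoc)
    then show ?thesis
      by (metis mset_subset_eq_add_left mset_subset_eq_add_right subset_mset.order_trans)
  qed
  ultimately show ?thesis
    by blast
qed

text \<open>\<open>LEAST\<close> has its defining property once some number has it; the group order
  does, by \<open>zero_sum_sublist\<close>.\<close>

lemma davenport_zero_sum:
  fixes S :: "'a::{ab_group_add, finite} multiset"
  assumes "davenport TYPE('a) \<le> size S"
  shows "\<exists>T. T \<subseteq># S \<and> T \<noteq> {#} \<and> \<Sum>\<^sub># T = 0"
proof -
  let ?P = "\<lambda>l. 0 < l \<and> (\<forall>S :: 'a multiset. l \<le> size S \<longrightarrow> (\<exists>T. T \<subseteq># S \<and> T \<noteq> {#} \<and> \<Sum>\<^sub># T = 0))"
  have "?P CARD('a)"
  proof (intro conjI allI impI)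
    fix S :: "'a multiset" assume le: "CARD('a) \<le> size S"
    obtain xs where xs: "mset xs = S"
      using ex_mset by blast
    then obtain ys where "mset ys \<subseteq># S" "ys \<noteq> []" "sum_list ys = 0"
      using zero_sum_sublist[of xs] le by auto
    then show "\<exists>T. T \<subseteq># S \<and> T \<noteq> {#} \<and> \<Sum>\<^sub># T = 0"
      by (intro exI[of _ "mset ys"]) (auto simp: sum_mset_sum_list)
  qed simp
  then have "?P (davenport TYPE('a))"
    unfolding davenport_def by (rule LeastI)
  then show ?thesis
    using assms by blast
qed

text \<open>Lifts a subsequence to a set of indices. As \<open>g\<close> may repeat values,
  \<open>Z\<close> is a choice: the induction takes \<open>x\<close> whenever \<open>g x\<close>
  still occurs in \<open>T\<close>.\<close>

lemma subseteq_image_mset_set: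
  assumes "finite X" "T \<subseteq># image_mset g (mset_set X)"
  obtains Z where "Z \<subseteq> X" "T = image_mset g (mset_set Z)"
  using assms
proof (induction X arbitrary: T thesis)
  case empty
  then show ?case by simp
next
  case (insert x X)
  show ?case
  proof (cases "g x \<in># T")
    case True
    then have "T - {#g x#} \<subseteq># image_mset g (mset_set X)"
      using insert by (simp add: subset_eq_diff_conv)
    then obtain Z where Z: "Z \<subseteq> X" "T - {#g x#} = image_mset g (mset_set Z)"
      using insert.IH by blast
    then have "finite Z" "x \<notin> Z"
      using insert finite_subset by auto
    then have "T = image_mset g (mset_set (insert x Z))"
      using Z True by (metis image_mset_add_mset insert_DiffM mset_set.insert)
    then show ?thesis
      using insert.prems(1)[of "insert x Z"] Z by blast
  next
    case False
    then have "T \<subseteq># image_mset g (mset_set X)"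
      using insert subset_eq_diff_conv[of T "{#g x#}" "image_mset g (mset_set X)"]
      by (simp add: diff_single_trivial)
    then show ?thesis
      using insert.IH insert.prems(1) by (metis subset_insertI2)
  qed
qed

lemma davenport_index_set:
  fixes g :: "'i \<Rightarrow> 'a::{ab_group_add, finite}"
  assumes "finite X" "davenport TYPE('a) \<le> card X"
  obtains Z where "Z \<subseteq> X" "Z \<noteq> {}" "sum g Z = 0"
proof -
  obtain T where T: "T \<subseteq># image_mset g (mset_set X)" "T \<noteq> {#}" "\<Sum>\<^sub># T = 0"
    using davenport_zero_sum[of "image_mset g (mset_set X)"] assms by auto
  then obtain Z where "Z \<subseteq> X" "T = image_mset g (mset_set Z)"
    using subseteq_image_mset_set assms by blast
  then show thesis
    using that[of Z] T by (cases "Z = {}") (auto simp: sum_unfold_sum_mset)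
qed

section \<open>Solution families of a subset-sum equation\<close>

text \<open>The target \<open>h\<close> is arbitrary because deleting an index \<open>i\<close> from
  the solutions that contain it changes the target to \<open>h - g i\<close>.\<close>

definition sum_sets :: "'i set \<Rightarrow> ('i \<Rightarrow> 'a::ab_group_add) \<Rightarrow> 'a \<Rightarrow> 'i set set" where
  "sum_sets X g h = {I. I \<subseteq> X \<and> sum g I = h}"

lemma finite_sum_sets: "finite X \<Longrightarrow> finite (sum_sets X g h)"
  unfolding sum_sets_def by simp

lemma sum_sets_remove:
  assumes "finite X" "i \<in> X"
  shows "{I \<in> sum_sets X g h. i \<notin> I} = sum_sets (X - {i}) g h"
    and "{I \<in> sum_sets X g h. i \<in> I} = insert i ` sum_sets (X - {i}) g (h - g i)"
proof -
  show "{I \<in> sum_sets X g h. i \<notin> I} = sum_sets (X - {i}) g h"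
    unfolding sum_sets_def by auto
  show "{I \<in> sum_sets X g h. i \<in> I} = insert i ` sum_sets (X - {i}) g (h - g i)" (is "?L = ?R")
  proof (intro equalityI subsetI)
    fix I assume I: "I \<in> ?L"
    then have "finite I"
      using assms finite_subset unfolding sum_sets_def by auto
    then have "I - {i} \<in> sum_sets (X - {i}) g (h - g i)"
      using I unfolding sum_sets_def by (auto simp: sum_diff1)
    moreover have "I = insert i (I - {i})"
      using I by auto
    ultimately show "I \<in> ?R"
      by (rule rev_image_eqI)
  next
    fix I assume "I \<in> ?R"
    then obtain J where J: "J \<subseteq> X - {i}" "sum g J = h - g i" "I = insert i J"
      unfolding sum_sets_def by auto
    moreover have "finite J" "i \<notin> J"
      using J assms finite_subset by auto
    ultimately show "I \<in> ?L"
      using assms unfolding sum_sets_def by auto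
  qed
qed

lemma card_sum_sets_remove:
  assumes "finite X" "i \<in> X"
  shows "card (sum_sets X g h) = card (sum_sets (X - {i}) g h) + card (sum_sets (X - {i}) g (h - g i))"
proof -
  let ?F = "sum_sets X g h"
  have "?F = {I \<in> ?F. i \<notin> I} \<union> {I \<in> ?F. i \<in> I}"
    by blast
  then have "card ?F = card {I \<in> ?F. i \<notin> I} + card {I \<in> ?F. i \<in> I}"
    using finite_sum_sets[OF assms(1), of g h]
    by (subst card_Un_disjoint[symmetric]) auto
  moreover have "inj_on (insert i) (sum_sets (X - {i}) g (h - g i))"
    unfolding sum_sets_def inj_on_def by blast
  ultimately show ?thesis
    by (simp add: sum_sets_remove[OF assms] card_image)
qed

lemma sum_flip:
  fixes g :: "'i \<Rightarrow> 'a::ab_group_add"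
  assumes "finite I" "finite Z"
  shows "sum g ((I - Z) \<union> (Z - I)) = sum g I + (\<Sum>i\<in>Z. if i \<in> I then - g i else g i)"
proof -
  have "(\<Sum>i\<in>Z. if i \<in> I then - g i else g i) = sum g (Z - I) - sum g (Z \<inter> I)"
    using assms by (simp add: sum.If_cases sum_negf Diff_eq Collect_neg_eq)
  moreover have "sum g I = sum g (I - Z) + sum g (Z \<inter> I)"
    using assms by (metis Int_commute sum.Int_Diff add.commute)
  moreover have "sum g ((I - Z) \<union> (Z - I)) = sum g (I - Z) + sum g (Z - I)"
    using assms by (intro sum.union_disjoint) auto
  ultimately show ?thesis
    by simp
qed

text \<open>Replacing \<open>g i\<close> by \<open>- g i\<close> for \<open>i\<close> in one solution turns the other solutions into zero-sum
  index sets, to which the Davenport constant applies.\<close>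

lemma sum_sets_separated:
  fixes g :: "'i \<Rightarrow> 'a::{ab_group_add, finite}"
  assumes "finite X" "davenport TYPE('a) \<le> card X" "sum_sets X g h \<noteq> {}"
  obtains i where "i \<in> X" "separates (sum_sets X g h) i"
proof -
  obtain I where I: "I \<subseteq> X" "sum g I = h"
    using assms unfolding sum_sets_def by auto
  obtain Z where Z: "Z \<subseteq> X" "Z \<noteq> {}" "(\<Sum>i\<in>Z. if i \<in> I then - g i else g i) = 0"
    using davenport_index_set[OF assms(1,2)] by blast
  have "finite I" "finite Z"
    using assms I Z finite_subset by auto
  then have "sum g ((I - Z) \<union> (Z - I)) = h"
    using sum_flip[of I Z g] I Z by simp
  then have "(I - Z) \<union> (Z - I) \<in> sum_sets X g h" "I \<in> sum_sets X g h"
    using I Z unfolding sum_sets_def by auto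
  moreover obtain i where i: "i \<in> Z"
    using Z by blast
  moreover have "i \<in> (I - Z) \<union> (Z - I) \<longleftrightarrow> i \<notin> I"
    using i by blast
  ultimately have "separates (sum_sets X g h) i"
    unfolding separates_def by metis
  then show thesis
    using that i Z(1) by blast
qed

lemma separates_sum_sets:
  assumes "finite X" "separates (sum_sets X g h) i"
  shows "i \<in> X" "sum_sets (X - {i}) g h \<noteq> {}" "sum_sets (X - {i}) g (h - g i) \<noteq> {}"
proof -
  show i: "i \<in> X"
    using assms unfolding separates_def sum_sets_def by auto
  show "sum_sets (X - {i}) g h \<noteq> {}" "sum_sets (X - {i}) g (h - g i) \<noteq> {}"
    using assms(2) sum_sets_remove[OF assms(1) i, of g h] unfolding separates_def by blast+
qed

text \<open>Deleting a separating index leaves two nonempty families on one index fewer, so the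
  bound doubles at each step. Once \<open>card X\<close> is below the Davenport constant, the bound
  is at most 1. The factor \<open>2 ^ davenport TYPE('a)\<close> avoids a subtraction in the
  exponent.\<close>

lemma card_sum_sets_ge:
  fixes g :: "'i \<Rightarrow> 'a::{ab_group_add, finite}"
  assumes "finite X" "sum_sets X g h \<noteq> {}"
  shows "2 ^ (card X + 1) \<le> 2 ^ davenport TYPE('a) * card (sum_sets X g h)"
  using assms
proof (induction "card X" arbitrary: X h rule: less_induct)
  case less
  show ?case
  proof (cases "davenport TYPE('a) \<le> card X")
    case True
    then obtain i where sep: "separates (sum_sets X g h) i"
      using sum_sets_separated less.prems by blast
    note * = separates_sum_sets[OF less.prems(1) this]
    have fin: "finite (X - {i})"
      using less.prems by simp
    have c: "card X = Suc (card (X - {i}))"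
      using * less.prems by (metis card.remove)
    have lt: "card (X - {i}) < card X"
      unfolding c by (rule lessI)
    have "2 ^ (card (X - {i}) + 1) \<le> 2 ^ davenport TYPE('a) * card (sum_sets (X - {i}) g h)"
      "2 ^ (card (X - {i}) + 1) \<le> 2 ^ davenport TYPE('a) * card (sum_sets (X - {i}) g (h - g i))"
      using less.hyps[OF lt fin *(2)] less.hyps[OF lt fin *(3)] by blast+
    then show ?thesis
      unfolding card_sum_sets_remove[OF less.prems(1) *(1)] c by (simp add: algebra_simps)
  next
    case False
    then have "(2::nat) ^ (card X + 1) \<le> 2 ^ davenport TYPE('a)"
      by (intro power_increasing) auto
    moreover have "1 \<le> card (sum_sets X g h)"
      using less.prems finite_sum_sets by (simp add: Suc_le_eq card_gt_0_iff)
    ultimately show ?thesis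
      by (metis le_trans mult.right_neutral mult_le_mono2)
  qed
qed

section \<open>Families attaining the lower bound\<close>

lemma extremal_xor3_closed:
  fixes g :: "'i \<Rightarrow> 'a::{ab_group_add, finite}"
  assumes "finite X" "2 ^ davenport TYPE('a) * card (sum_sets X g h) = 2 ^ (card X + 1)"
    and "A \<in> sum_sets X g h" "B \<in> sum_sets X g h" "C \<in> sum_sets X g h"
  shows "xor3 A B C \<in> sum_sets X g h"
  using assms
proof (induction "card X" arbitrary: X h A B C rule: less_induct)
  case less
  let ?F = "sum_sets X g h"
  let ?D = "davenport TYPE('a)"
  \<comment> \<open>A divisor of a power of two is a power of two, as
    \<open>xor3_closed_of_local\<close> requires. Its local hypothesis is vacuous when no index
    separates, so the induction has no separate base case.\<close>
  have "card ?F dvd 2 ^ (card X + 1)"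
    using less.prems(2) by (metis dvd_triv_right)
  then obtain k where k: "card ?F = 2 ^ k"
    using divides_primepow_nat two_is_prime_nat by blast
  show ?case
  proof (rule xor3_closed_of_local[OF k _ less.prems(3-5)])
    fix i A B C
    assume sep: "separates ?F i" and ABC: "A \<in> ?F" "B \<in> ?F" "C \<in> ?F"
      and eq: "(i \<in> A) = (i \<in> B)" "(i \<in> B) = (i \<in> C)"
    note * = separates_sum_sets[OF less.prems(1) sep]
    let ?Fout = "sum_sets (X - {i}) g h" and ?Fin = "sum_sets (X - {i}) g (h - g i)"
    have fin: "finite (X - {i})"
      using less.prems by simp
    have c: "card X = Suc (card (X - {i}))"
      using * less.prems by (metis card.remove)
    have lt: "card (X - {i}) < card X"
      unfolding c by (rule lessI)
    have squeeze: "a = n \<and> b = n" if "a + b = n + n" "n \<le> a" "n \<le> b" for a b n :: nat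
      using that by linarith
    have "2 ^ ?D * card ?Fout + 2 ^ ?D * card ?Fin = 2 ^ ?D * card ?F"
      by (simp only: card_sum_sets_remove[OF less.prems(1) *(1)] distrib_left)
    also have "\<dots> = 2 ^ (card (X - {i}) + 1) + 2 ^ (card (X - {i}) + 1)"
      unfolding less.prems(2) c by (simp only: power_Suc add_Suc mult_2)
    finally have half: "2 ^ ?D * card ?Fout = 2 ^ (card (X - {i}) + 1)" "2 ^ ?D * card ?Fin = 2 ^ (card (X - {i}) + 1)"
      using squeeze card_sum_sets_ge[OF fin *(2)] card_sum_sets_ge[OF fin *(3)] by blast+
    note rem = sum_sets_remove[OF less.prems(1) *(1), of g h]
    show "xor3 A B C \<in> ?F"
    proof (cases "i \<in> A")
      case True
      have "\<exists>I\<in>?Fin. P = insert i I" if "P \<in> ?F" "i \<in> P" for P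
        using rem(2) that by auto
      then obtain A' B' C' where A': "A' \<in> ?Fin" "B' \<in> ?Fin" "C' \<in> ?Fin"
        and eqs: "A = insert i A'" "B = insert i B'" "C = insert i C'"
        using True ABC eq by metis
      have "xor3 A' B' C' \<in> ?Fin"
        by (rule less.hyps[OF lt fin half(2) A'])
      \<comment> \<open>The index \<open>i\<close> lies in all three sets, an odd number, so it
        survives in the sum.\<close>
      moreover have "xor3 A B C = insert i (xor3 A' B' C')"
        unfolding eqs by auto
      ultimately show ?thesis
        using rem(2) by blast
    next
      case False
      then have "A \<in> ?Fout" "B \<in> ?Fout" "C \<in> ?Fout"
        using rem(1) ABC eq by blast+
      then have "xor3 A B C \<in> ?Fout"
        by (rule less.hyps[OF lt fin half(1)])
      then show ?thesis
        using rem(1) by blast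
    qed
  qed
qed

text \<open>Translation by \<open>x\<close> permutes the group, so adding \<open>x\<close> once for
  every element leaves the sum of all elements unchanged. An odd number of copies of
  \<open>x\<close> amounts to \<open>x\<close> itself, as \<open>x + x = 0\<close>.\<close>

lemma odd_card_double_eq_0:
  fixes x :: "'a::{ab_group_add, finite}"
  assumes "odd CARD('a)" "x + x = 0"
  shows "x = 0"
proof -
  have const: "(\<Sum>y\<in>A. x) = (if even (card A) then 0 else x)" if "finite A" for A :: "'a set"
    using that by induction (auto simp: assms(2))
  have "(\<Sum>y\<in>UNIV. y) = (\<Sum>y\<in>UNIV. y + x)"
    by (rule sum.reindex_bij_witness[of _ "\<lambda>y. y + x" "\<lambda>y. y - x"]) auto
  also have "\<dots> = (\<Sum>y\<in>UNIV. y) + x"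
    using const[of UNIV] assms(1) by (simp add: sum.distrib)
  finally show ?thesis
    by simp
qed

lemma extremal_zero_sum_Int:
  fixes g :: "'i \<Rightarrow> 'a::{ab_group_add, finite}"
  assumes "odd CARD('a)" "finite X" "2 ^ davenport TYPE('a) * card (sum_sets X g 0) = 2 ^ (card X + 1)"
    and I: "I \<in> sum_sets X g 0" and J: "J \<in> sum_sets X g 0"
  shows "I \<inter> J \<in> sum_sets X g 0"
proof -
  have fin: "finite I" "finite J"
    using assms finite_subset unfolding sum_sets_def by auto
  \<comment> \<open>The empty set is a solution for target 0, which turns closure under triple sums
    into closure under symmetric difference.\<close>
  have "xor3 I J {} \<in> sum_sets X g 0"
    using assms by (intro extremal_xor3_closed) (auto simp: sum_sets_def)
  moreover have "xor3 I J {} = (I - J) \<union> (J - I)"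
    by auto
  ultimately have "sum g (I - J) + sum g (J - I) = 0"
    using fin sum.union_disjoint[of "I - J" "J - I" g] unfolding sum_sets_def by auto
  moreover have "sum g (I \<inter> J) + sum g (I - J) = 0" "sum g (I \<inter> J) + sum g (J - I) = 0"
    using I J fin sum.Int_Diff[of I g J] sum.Int_Diff[of J g I] unfolding sum_sets_def
    by (auto simp: Int_commute)
  ultimately have "sum g (I \<inter> J) + sum g (I \<inter> J) = 0"
    by (metis add.commute add_left_cancel)
  then have "sum g (I \<inter> J) = 0"
    using odd_card_double_eq_0 assms(1) by blast
  then show ?thesis
    using I unfolding sum_sets_def by auto
qed

section \<open>Minimal zero-sum index sets\<close>

definition min_sets :: "'i set \<Rightarrow> ('i \<Rightarrow> 'a::ab_group_add) \<Rightarrow> 'i set set" where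
  "min_sets X g = {I \<in> sum_sets X g 0. I \<noteq> {} \<and> (\<forall>J\<in>sum_sets X g 0. J \<subset> I \<longrightarrow> J = {})}"

text \<open>A nonempty zero-sum set that is not minimal splits into a smaller zero-sum set
  \<open>J\<close> and its complement \<open>Z - J\<close>, again zero-sum and smaller.\<close>

lemma sum_sets_Union_min_sets:
  assumes "finite X" "Z \<in> sum_sets X g 0"
  shows "\<exists>\<M>\<subseteq>min_sets X g. Z = \<Union>\<M>"
proof -
  have "finite Z"
    using assms finite_subset unfolding sum_sets_def by auto
  then show ?thesis
    using assms(2)
  proof (induction Z rule: finite_psubset_induct)
    case (psubset Z)
    show ?case
    proof (cases "Z = {} \<or> Z \<in> min_sets X g")
      case True
      then show ?thesis
        by (metis Sup_empty cSup_singleton empty_subsetI insert_subset)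
    next
      case False
      then obtain J where J: "J \<in> sum_sets X g 0" "J \<subset> Z" "J \<noteq> {}"
        using psubset.prems unfolding min_sets_def by auto
      have "sum g (Z - J) = 0"
        using J psubset unfolding sum_sets_def by (simp add: sum_diff psubset_imp_subset)
      then have "Z - J \<in> sum_sets X g 0" "Z - J \<subset> Z"
        using J psubset.prems unfolding sum_sets_def by auto
      then obtain \<M> \<N> where "\<M> \<subseteq> min_sets X g" "J = \<Union>\<M>" "\<N> \<subseteq> min_sets X g" "Z - J = \<Union>\<N>"
        using psubset.IH J by meson
      moreover have "Z = J \<union> (Z - J)"
        using J by auto
      ultimately show ?thesis
        by (intro exI[of _ "\<M> \<union> \<N>"]) auto
    qed
  qed
qed

text \<open>Taking unions is a bijection from subfamilies of \<open>min_sets X g\<close> to zero-sum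
  sets: disjoint nonempty sets can be read off from their union.\<close>

lemma card_sum_sets_min_sets:
  assumes "finite X" and disj: "pairwise disjnt (min_sets X g)"
  shows "card (sum_sets X g 0) = 2 ^ card (min_sets X g)"
proof -
  let ?M = "min_sets X g"
  have sub: "?M \<subseteq> sum_sets X g 0"
    unfolding min_sets_def by auto
  have fin: "finite ?M"
    using sub finite_sum_sets[OF assms(1)] finite_subset by blast
  have "inj_on Union (Pow ?M)"
  proof (rule inj_onI)
    have *: "\<M> \<subseteq> \<N>" if MN: "\<M> \<subseteq> ?M" "\<N> \<subseteq> ?M" "\<Union>\<M> = \<Union>\<N>" for \<M> \<N>
    proof
      fix I assume I: "I \<in> \<M>"
      then have "I \<noteq> {}"
        using MN I unfolding min_sets_def by auto
      then obtain i where i: "i \<in> I"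
        by blast
      then obtain J where J: "J \<in> \<N>" "i \<in> J"
        using MN(3) I i by blast
      then have "I = J"
        using disj i I MN J unfolding pairwise_def disjnt_def by blast
      then show "I \<in> \<N>"
        using J by simp
    qed
    fix \<M> \<N> assume "\<M> \<in> Pow ?M" "\<N> \<in> Pow ?M" "\<Union>\<M> = \<Union>\<N>"
    then show "\<M> = \<N>"
      using *[of \<M> \<N>] *[of \<N> \<M>] by auto
  qed
  moreover have "Union ` Pow ?M = sum_sets X g 0"
  proof (intro equalityI subsetI)
    fix Z assume "Z \<in> Union ` Pow ?M"
    then obtain \<M> where \<M>: "\<M> \<subseteq> ?M" "Z = \<Union>\<M>"
      by auto
    have "\<forall>I\<in>\<M>. finite I"
      using \<M> assms finite_subset unfolding min_sets_def sum_sets_def by blast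
    moreover have "\<forall>I\<in>\<M>. \<forall>J\<in>\<M>. I \<noteq> J \<longrightarrow> I \<inter> J = {}"
      using \<M>(1) disj unfolding pairwise_def disjnt_def by blast
    ultimately have "sum g Z = sum (sum g) \<M>"
      unfolding \<M>(2) by (simp add: sum.Union_disjoint)
    also have "\<dots> = 0"
      using \<M> unfolding min_sets_def sum_sets_def by (intro sum.neutral) auto
    finally show "Z \<in> sum_sets X g 0"
      using \<M> unfolding min_sets_def sum_sets_def by auto
  next
    fix Z assume "Z \<in> sum_sets X g 0"
    then show "Z \<in> Union ` Pow ?M"
      using sum_sets_Union_min_sets[OF assms(1)] by blast
  qed
  ultimately show ?thesis
    using card_image[of Union "Pow ?M"] fin by (simp add: card_Pow)
qed

section \<open>From index sets back to subsequences\<close>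

lemma image_mset_set_mono:
  assumes "J \<subseteq> I" "finite I"
  shows "image_mset g (mset_set J) \<subseteq># image_mset g (mset_set I)"
  using assms by (intro image_mset_subseteq_mono) (simp add: finite_subset subset_imp_msubset_mset_set)

lemma min_sets_iff:
  assumes "finite X" "I \<subseteq> X"
  shows "I \<in> min_sets X g \<longleftrightarrow> minimal_zero_sum (image_mset g (mset_set I))"
proof -
  let ?\<mu> = "\<lambda>I. image_mset g (mset_set I)"
  have fin: "finite I"
    using assms finite_subset by blast
  have sum: "\<Sum>\<^sub># (?\<mu> J) = sum g J" for J
    by (simp add: sum_unfold_sum_mset)
  have "(\<forall>J\<in>sum_sets X g 0. J \<subset> I \<longrightarrow> J = {}) \<longleftrightarrow> (\<forall>T. T \<subset># ?\<mu> I \<and> T \<noteq> {#} \<longrightarrow> \<Sum>\<^sub># T \<noteq> 0)"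
    (is "?L \<longleftrightarrow> ?R")
  proof
    assume L: ?L
    show ?R
    proof (intro allI impI notI)
      fix T assume T: "T \<subset># ?\<mu> I \<and> T \<noteq> {#}" "\<Sum>\<^sub># T = 0"
      then obtain J where J: "J \<subseteq> I" "T = ?\<mu> J"
        using subseteq_image_mset_set[OF fin, of T g] by (metis subset_mset.less_imp_le)
      then have "J \<subset> I" "J \<in> sum_sets X g 0"
        using T assms sum unfolding sum_sets_def by auto
      then show False
        using L J T by auto
    qed
  next
    assume R: ?R
    show ?L
    proof (intro ballI impI)
      fix J assume J: "J \<in> sum_sets X g 0" "J \<subset> I"
      then have finJ: "finite J"
        using fin finite_subset by blast
      have "?\<mu> J \<subseteq># ?\<mu> I"
        using J fin by (intro image_mset_set_mono) auto
      \<comment> \<open>Strictness comes from the length, which counts indices even where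
        \<open>g\<close> repeats values.\<close>
      moreover have "size (?\<mu> J) < size (?\<mu> I)"
        using psubset_card_mono[OF fin J(2)] by simp
      ultimately have "?\<mu> J \<subset># ?\<mu> I"
        by (metis nless_le subset_mset.le_less)
      then have "?\<mu> J = {#}"
        using R J sum[of J] unfolding sum_sets_def by auto
      then show "J = {}"
        using finJ by (simp add: mset_set_empty_iff)
    qed
  qed
  then show ?thesis
    using assms fin sum unfolding min_sets_def minimal_zero_sum_def
    by (auto simp: sum_sets_def mset_set_empty_iff)
qed

theorem theorem3p5:
  fixes S :: "'a::{ab_group_add, finite} multiset"
  assumes "odd CARD('a)"
    and "0 \<notin># S"
    and "real (N0 S) = 2 powi (int (size S) - int (davenport TYPE('a)) + 1)"
  shows "int (card {T. T \<subseteq># S \<and> minimal_zero_sum T}) = int (size S) - int (davenport TYPE('a)) + 1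
    \<and> pairwise (\<lambda>T\<^sub>1 T\<^sub>2. T\<^sub>1 \<inter># T\<^sub>2 = {#}) {T. T \<subseteq># S \<and> minimal_zero_sum T}"
proof -
  obtain xs where xs: "mset xs = S"
    using ex_mset by blast
  define X where "X = {..<length xs}"
  define g where "g = (!) xs"
  define \<mu> where "\<mu> I = image_mset g (mset_set I)" for I
  let ?F = "sum_sets X g 0" and ?M = "min_sets X g" and ?D = "davenport TYPE('a)"
  let ?T = "{T. T \<subseteq># S \<and> minimal_zero_sum T}"
  have X: "finite X" "card X = size S"
    unfolding X_def using xs by auto
  have \<mu>X: "\<mu> X = S"
    unfolding \<mu>_def X_def g_def using xs
    by (metis atLeast0LessThan map_nth mset_map mset_upt)
  have N0: "N0 S = card ?F"
    using N0_mset[of xs] unfolding xs sum_sets_def X_def g_def .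
  have ne0: "g i \<noteq> 0" if "i \<in> X" for i
    using that assms(2) unfolding X_def g_def xs[symmetric] by (metis lessThan_iff nth_mem set_mset_mset)
  have "{} \<in> ?F"
    unfolding sum_sets_def by auto
  then have "1 \<le> card ?F"
    using finite_sum_sets[OF X(1)] by (metis One_nat_def Suc_leI card_gt_0_iff empty_iff)
  \<comment> \<open>The empty index set gives \<open>N0 S \<ge> 1\<close>, which rules out a
    negative integer exponent.\<close>
  have exp: "0 \<le> int (size S) - int ?D + 1"
  proof (rule ccontr)
    assume "\<not> ?thesis"
    then have "(2::real) powi (int (size S) - int ?D + 1) < 2 powi 0"
      by (intro power_int_strict_increasing) auto
    then show False
      using assms(3) N0 \<open>1 \<le> card ?F\<close> by simp
  qed
  \<comment> \<open>Adding 1 before the truncated subtraction keeps the case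
    \<open>?D = size S + 1\<close> exact.\<close>
  define k where "k = size S + 1 - ?D"
  have k: "int (size S) - int ?D + 1 = int k" "?D + k = size S + 1"
    using exp unfolding k_def by auto
  have cardF: "card ?F = 2 ^ k"
  proof -
    have "real (card ?F) = real (2 ^ k)"
      using assms(3) unfolding N0 k(1) by simp
    then show ?thesis
      by (simp only: of_nat_eq_iff)
  qed
  then have extremal: "2 ^ ?D * card ?F = 2 ^ (card X + 1)"
    using k(2) X(2) by (metis power_add)
  note Int = extremal_zero_sum_Int[OF assms(1) X(1) extremal]
  have disj: "I \<inter> J = {}" if "I \<in> ?M" "J \<in> ?M" "I \<noteq> J" for I J
  proof -
    have "I \<inter> J \<in> ?F"
      using Int that unfolding min_sets_def by blast
    \<comment> \<open>A zero-sum set properly inside a minimal one is empty.\<close>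
    moreover have "I \<inter> J \<subset> I \<or> I \<inter> J \<subset> J"
      using that(3) by blast
    ultimately show ?thesis
      using that unfolding min_sets_def by blast
  qed
  text \<open>A term common to two minimal sets could be swapped into the first one; the intersection
    lemma, applied before and after the swap, would then make that term zero.\<close>
  have \<mu>disj: "\<mu> I \<inter># \<mu> J = {#}" if IJ: "I \<in> ?M" "J \<in> ?M" "I \<noteq> J" for I J
  proof (rule ccontr)
    assume "\<mu> I \<inter># \<mu> J \<noteq> {#}"
    then obtain x where x: "x \<in># \<mu> I" "x \<in># \<mu> J"
      by (metis multiset_nonemptyE Multiset.inter_iff)
    have sub: "I \<subseteq> X" "J \<subseteq> X" "sum g I = 0"
      using IJ unfolding min_sets_def sum_sets_def by auto
    then have fin: "finite I" "finite J"
      using X finite_subset by auto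
    obtain i j where ij: "i \<in> I" "j \<in> J" "g i = g j"
      using x fin unfolding \<mu>_def by auto
    have "j \<notin> I"
      using ij disj[OF IJ] by blast
    then have "sum g (insert j (I - {i})) = 0"
      using sub fin ij by (simp add: sum_diff1)
    then have "insert j (I - {i}) \<in> ?F" "I \<in> ?F"
      using sub ij unfolding sum_sets_def by auto
    then have "insert j (I - {i}) \<inter> I \<in> ?F"
      by (rule Int)
    moreover have "insert j (I - {i}) \<inter> I = I - {i}"
      using \<open>j \<notin> I\<close> by auto
    ultimately have "sum g (I - {i}) = 0"
      unfolding sum_sets_def by simp
    then have "g i = 0"
      using sub fin ij by (simp add: sum_diff1)
    then show False
      using ne0 sub ij by blast
  qed
  have img: "\<mu> ` ?M = ?T"
  proof (intro equalityI subsetI)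
    fix T assume "T \<in> \<mu> ` ?M"
    then obtain I where I: "I \<in> ?M" "T = \<mu> I"
      by blast
    then have "I \<subseteq> X"
      unfolding min_sets_def sum_sets_def by auto
    then show "T \<in> ?T"
      using I X min_sets_iff[of X I g] image_mset_set_mono[of I X g] \<mu>X unfolding \<mu>_def by auto
  next
    fix T assume T: "T \<in> ?T"
    then obtain I where "I \<subseteq> X" "T = \<mu> I"
      using subseteq_image_mset_set[OF X(1), of T g] \<mu>X unfolding \<mu>_def by auto
    then show "T \<in> \<mu> ` ?M"
      using T X min_sets_iff[of X I g] unfolding \<mu>_def by auto
  qed
  \<comment> \<open>If distinct minimal sets had the same image, the gcd of the two images would be
    that nonempty sequence itself, against \<open>\<mu>disj\<close>.\<close>
  have "inj_on \<mu> ?M"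
  proof (rule inj_onI, rule ccontr)
    fix I J assume IJ: "I \<in> ?M" "J \<in> ?M" "\<mu> I = \<mu> J" "I \<noteq> J"
    then have "\<mu> I \<in> ?T"
      using img by blast
    then have "\<mu> I \<noteq> {#}"
      unfolding minimal_zero_sum_def by blast
    then show False
      using \<mu>disj[OF IJ(1,2,4)] IJ(3) by simp
  qed
  then have "card ?T = card ?M"
    using card_image img by metis
  moreover have "card ?M = k"
    using card_sum_sets_min_sets[OF X(1), of g] disj cardF by (simp add: pairwise_def disjnt_def)
  moreover have "pairwise (\<lambda>T\<^sub>1 T\<^sub>2. T\<^sub>1 \<inter># T\<^sub>2 = {#}) ?T"
    unfolding img[symmetric] pairwise_def using \<mu>disj by blast
  ultimately show ?thesis
    using k(1) by simp
qed

end
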